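(* Let $F$ be a field of characteristic $0$, let $\varphi\in F[x,y,z]$ and let $(f,g,h)$ be its corresponding Nagata homomorphism. Then the determinant of the Jacobian matrix $J(f,g,h)$ is a nonzero constant in $F$ if and only if $(f,g,h)$ is an automorphism of $F[x,y,z]$. In this case, there exists a polynomial $p\in F[t_1,t_2]$ such that $\varphi=p(xz+y^2,z)$; moreover the inverse of $(f,g,h)$ is $(f',g',h')$, where $$f'=x+2y\varphi-z\varphi^2,\qquad g'=y-z\varphi,\qquad h'=z.$$
   Context: For $\varphi\in F[x,y,z]$, the corresponding Nagata homomorphism is the $F$-algebra homomorphism $F[x,y,z]\to F[x,y,z]$ given by $x\mapsto f$, $y\mapsto g$, $z\mapsto h$ (equivalently, the polynomial map $F^3\to F^3$ with components $f,g,h$), denoted by the triple $(f,g,h)$, where $$f=x-2y\varphi-z\varphi^2,\qquad g=y+z\varphi,\qquad h=z.$$ $J(f,g,h)$ is the $3\times 3$ matrix of partial derivatives of $f,g,h$ with respect to $x,y,z$. *)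

theory Defs
  imports "HOL-Computational_Algebra.Polynomial" "HOL-Analysis.Determinants"
begin

text \<open>
  The polynomial ring \<open>F[x,y,z]\<close> is represented as the iterated polynomial ring \<open>F[x][y][z]\<close>:
  \<open>x\<close> is the innermost and \<open>z\<close> the outermost variable. Likewise \<open>F[t\<^sub>1,t\<^sub>2]\<close> is \<open>F[t\<^sub>1][t\<^sub>2]\<close>.
\<close>

type_synonym 'a poly2 = "'a poly poly"
type_synonym 'a poly3 = "'a poly poly poly"

definition const3 :: "'a::zero \<Rightarrow> 'a poly3" where
  "const3 c = [:[:[:c:]:]:]"

definition X :: "'a::comm_ring_1 poly3" where "X = [:[:[:0, 1:]:]:]"
definition Y :: "'a::comm_ring_1 poly3" where "Y = [:[:0, 1:]:]"
definition Z :: "'a::comm_ring_1 poly3" where "Z = [:0, 1:]"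

definition subst1 :: "'a::comm_ring_1 poly3 \<Rightarrow> 'a poly \<Rightarrow> 'a poly3" where
  "subst1 a p = poly (map_poly const3 p) a"

definition subst2 :: "'a::comm_ring_1 poly3 \<Rightarrow> 'a poly3 \<Rightarrow> 'a poly2 \<Rightarrow> 'a poly3" where
  "subst2 a b p = poly (map_poly (subst1 a) p) b"

text \<open>\<open>subst3 a b c\<close> is the \<open>F\<close>-algebra endomorphism of \<open>F[x,y,z]\<close> written as the triple \<open>(a,b,c)\<close>.\<close>

definition subst3 :: "'a::comm_ring_1 poly3 \<Rightarrow> 'a poly3 \<Rightarrow> 'a poly3 \<Rightarrow> 'a poly3 \<Rightarrow> 'a poly3" where
  "subst3 a b c p = poly (map_poly (subst2 a b) p) c"

definition algebra_hom :: "('a::comm_ring_1 poly3 \<Rightarrow> 'a poly3) \<Rightarrow> bool" where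
  "algebra_hom \<Phi> \<longleftrightarrow>
     (\<forall>p q. \<Phi> (p + q) = \<Phi> p + \<Phi> q) \<and>
     (\<forall>p q. \<Phi> (p * q) = \<Phi> p * \<Phi> q) \<and>
     (\<forall>c. \<Phi> (const3 c) = const3 c)"

definition algebra_automorphism :: "('a::comm_ring_1 poly3 \<Rightarrow> 'a poly3) \<Rightarrow> bool" where
  "algebra_automorphism \<Phi> \<longleftrightarrow> algebra_hom \<Phi> \<and> bij \<Phi>"

definition dX :: "'a::idom poly3 \<Rightarrow> 'a poly3" where "dX = map_poly (map_poly pderiv)"
definition dY :: "'a::idom poly3 \<Rightarrow> 'a poly3" where "dY = map_poly pderiv"
definition dZ :: "'a::idom poly3 \<Rightarrow> 'a poly3" where "dZ = pderiv"

definition jacobian :: "'a::idom poly3 \<Rightarrow> 'a poly3 \<Rightarrow> 'a poly3 \<Rightarrow> 'a poly3 ^ 3 ^ 3" where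
  "jacobian a b c = vector
     [vector [dX a, dY a, dZ a],
      vector [dX b, dY b, dZ b],
      vector [dX c, dY c, dZ c]]"

definition nagata_f :: "'a::comm_ring_1 poly3 \<Rightarrow> 'a poly3" where
  "nagata_f \<phi> = X - 2 * Y * \<phi> - Z * \<phi>\<^sup>2"

definition nagata_g :: "'a::comm_ring_1 poly3 \<Rightarrow> 'a poly3" where
  "nagata_g \<phi> = Y + Z * \<phi>"

definition nagata_h :: "'a::comm_ring_1 poly3 \<Rightarrow> 'a poly3" where
  "nagata_h \<phi> = Z"

definition nagata :: "'a::comm_ring_1 poly3 \<Rightarrow> 'a poly3 \<Rightarrow> 'a poly3" where
  "nagata \<phi> = subst3 (nagata_f \<phi>) (nagata_g \<phi>) (nagata_h \<phi>)"

lemma const3_simps [simp]: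
  "const3 0 = 0" "const3 1 = 1"
  "const3 (a + b) = const3 a + const3 b"
  "const3 (a * b) = const3 a * const3 (b :: 'a::comm_ring_1)"
  by (simp_all add: const3_def one_pCons)

lemma poly_map_poly_hom:
  fixes h :: "'b::comm_ring_1 \<Rightarrow> 'c::comm_ring_1"
  assumes "h 0 = 0" "\<And>u v. h (u + v) = h u + h v" "\<And>u v. h (u * v) = h u * h v"
  shows "poly (map_poly h (p + q)) t = poly (map_poly h p) t + poly (map_poly h q) t"
    and "poly (map_poly h (p * q)) t = poly (map_poly h p) t * poly (map_poly h q) t"
proof -
  have add: "map_poly h (p + q) = map_poly h p + map_poly h q" for p q
    by (rule poly_eqI) (simp add: coeff_map_poly assms)
  have smult: "map_poly h (smult c q) = smult (h c) (map_poly h q)" for c q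
    by (rule poly_eqI) (simp add: coeff_map_poly assms)
  have pCons: "map_poly h (pCons c q) = pCons (h c) (map_poly h q)" for c q
    by (rule poly_eqI) (simp add: coeff_map_poly assms coeff_pCons split: nat.split)
  show "poly (map_poly h (p + q)) t = poly (map_poly h p) t + poly (map_poly h q) t"
    by (simp add: add)
  show "poly (map_poly h (p * q)) t = poly (map_poly h p) t * poly (map_poly h q) t"
    by (induction p) (simp_all add: add smult pCons assms algebra_simps)
qed

lemma subst1_simps [simp]:
  "subst1 a [:c:] = const3 c" "subst1 a 0 = 0" "subst1 a 1 = 1" "subst1 a [:0, 1:] = a"
  "subst1 a (p + q) = subst1 a p + subst1 a q"
  "subst1 a (p * q) = subst1 a p * subst1 a q"
  by (simp_all add: subst1_def map_poly_pCons poly_map_poly_hom)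

lemma subst2_simps [simp]:
  "subst2 a b [:r:] = subst1 a r" "subst2 a b 0 = 0" "subst2 a b 1 = 1" "subst2 a b [:0, 1:] = b"
  "subst2 a b (p + q) = subst2 a b p + subst2 a b q"
  "subst2 a b (p * q) = subst2 a b p * subst2 a b q"
  by (simp_all add: subst2_def map_poly_pCons poly_map_poly_hom)

lemma subst3_simps [simp]:
  "subst3 a b c X = a" "subst3 a b c Y = b" "subst3 a b c Z = c"
  "subst3 a b c (const3 k) = const3 k"
  "subst3 a b c (p + q) = subst3 a b c p + subst3 a b c q"
  "subst3 a b c (p * q) = subst3 a b c p * subst3 a b c q"
  by (simp_all add: subst3_def X_def Y_def Z_def const3_def map_poly_pCons poly_map_poly_hom)

lemma algebra_hom_subst3: "algebra_hom (subst3 a b c)"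
  by (simp add: algebra_hom_def)

end

theory Submission
  imports Defs
begin

text \<open>
  The Jacobian determinant equals \<open>1 + D \<phi>\<close> for the derivation
  \<open>D = z \<partial>/\<partial>y - 2y \<partial>/\<partial>x\<close>. Since every value of \<open>D\<close> lies in the ideal \<open>(y,z)\<close>, the
  determinant is constant iff \<open>D \<phi> = 0\<close>. An element of the kernel of \<open>D\<close> is determined by
  its restriction to \<open>y = 0\<close>, and this restriction only involves monomials \<open>x\<^sup>i z\<^sup>k\<close> with
  \<open>i \<le> k\<close>, i.e. it is the restriction of some \<open>p(xz + y\<^sup>2, z)\<close>; so the kernel is
  \<open>F[xz + y\<^sup>2, z]\<close>. As \<open>xz + y\<^sup>2\<close> and \<open>z\<close> are fixed by the Nagata homomorphism, so is \<open>\<phi>\<close>,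
  and the formula for the inverse is immediate. Conversely, by the chain rule, surjectivity
  alone makes the determinant a unit.
\<close>

section \<open>Algebra homomorphisms and substitution\<close>

lemma algebra_hom_simps:
  assumes "algebra_hom \<Phi>"
  shows "\<Phi> (p + q) = \<Phi> p + \<Phi> q" "\<Phi> (p * q) = \<Phi> p * \<Phi> q" "\<Phi> (const3 c) = const3 c"
    "\<Phi> 0 = 0" "\<Phi> 1 = 1" "\<Phi> (- p) = - \<Phi> p" "\<Phi> (p - q) = \<Phi> p - \<Phi> q" "\<Phi> (p ^ n) = \<Phi> p ^ n"
    "\<Phi> (numeral w) = numeral w"
proof -
  show add: "\<Phi> (p + q) = \<Phi> p + \<Phi> q" for p q using assms by (simp add: algebra_hom_def)
  show mult: "\<Phi> (p * q) = \<Phi> p * \<Phi> q" for p q using assms by (simp add: algebra_hom_def)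
  show const: "\<Phi> (const3 c) = const3 c" for c using assms by (simp add: algebra_hom_def)
  show 0: "\<Phi> 0 = 0" and 1: "\<Phi> 1 = 1" using const[of 0] const[of 1] by simp_all
  show minus: "\<Phi> (- p) = - \<Phi> p" for p
    using add[of p "- p"] 0 by (metis add.right_inverse minus_unique)
  show "\<Phi> (p - q) = \<Phi> p - \<Phi> q" using add[of p "- q"] minus by simp
  show "\<Phi> (p ^ n) = \<Phi> p ^ n" by (induction n) (simp_all add: 1 mult)
  have "\<Phi> (of_nat m) = of_nat m" for m by (induction m) (simp_all add: 0 1 add)
  from this[of "numeral w"] show "\<Phi> (numeral w) = numeral w" by simp
qed

lemma subst_pCons:
  "subst1 a (pCons k p) = const3 k + a * subst1 a p"
  "subst2 a b (pCons r q) = subst1 a r + b * subst2 a b q"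
  "subst3 a b c (pCons s t) = subst2 a b s + c * subst3 a b c t"
  by (simp_all add: subst1_def subst2_def subst3_def map_poly_pCons)

lemma subst_0 [simp]: "subst3 a b c 0 = 0"
  by (simp add: subst3_def)

lemma algebra_hom_subst1:
  assumes "algebra_hom \<Phi>"
  shows "\<Phi> (subst1 a p) = subst1 (\<Phi> a) p"
  by (induction p) (simp_all add: subst_pCons algebra_hom_simps[OF assms])

lemma algebra_hom_subst2:
  assumes "algebra_hom \<Phi>"
  shows "\<Phi> (subst2 a b p) = subst2 (\<Phi> a) (\<Phi> b) p"
  by (induction p)
    (simp_all add: subst_pCons algebra_hom_simps[OF assms] algebra_hom_subst1[OF assms])

text \<open>Homomorphisms pass through the nested Horner evaluation. Together with
  \<open>subst3_X_Y_Z\<close> this reduces identities between composites of endomorphisms to the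
  three generators.\<close>

lemma algebra_hom_comp_subst3:
  assumes "algebra_hom \<Phi>"
  shows "\<Phi> (subst3 a b c p) = subst3 (\<Phi> a) (\<Phi> b) (\<Phi> c) p"
  by (induction p)
    (simp_all add: subst_pCons algebra_hom_simps[OF assms] algebra_hom_subst2[OF assms])

lemma subst1_X: "subst1 X p = [:[:p:]:]"
  by (induction p) (simp_all add: subst_pCons X_def const3_def)

lemma subst2_X_Y: "subst2 X Y p = [:p:]"
  by (induction p) (simp_all add: subst_pCons Y_def subst1_X)

lemma subst3_X_Y_Z: "subst3 X Y Z p = p"
  by (induction p) (simp_all add: subst_pCons Z_def subst2_X_Y)

section \<open>Derivations and the chain rule\<close>

definition derivation :: "('a::comm_ring_1 poly3 \<Rightarrow> 'a poly3) \<Rightarrow> bool" where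
  "derivation \<delta> \<longleftrightarrow>
     (\<forall>p q. \<delta> (p + q) = \<delta> p + \<delta> q) \<and>
     (\<forall>p q. \<delta> (p * q) = p * \<delta> q + q * \<delta> p) \<and>
     (\<forall>c. \<delta> (const3 c) = 0)"

lemma derivation_simps:
  assumes "derivation \<delta>"
  shows "\<delta> (p + q) = \<delta> p + \<delta> q" "\<delta> (p * q) = p * \<delta> q + q * \<delta> p" "\<delta> (const3 c) = 0"
    "\<delta> 0 = 0" "\<delta> (- p) = - \<delta> p" "\<delta> (p - q) = \<delta> p - \<delta> q" "\<delta> (p\<^sup>2) = 2 * p * \<delta> p"
    "\<delta> (numeral w) = 0"
proof -
  show add: "\<delta> (p + q) = \<delta> p + \<delta> q" for p q using assms by (simp add: derivation_def)
  show mult: "\<delta> (p * q) = p * \<delta> q + q * \<delta> p" for p q using assms by (simp add: derivation_def)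
  show const: "\<delta> (const3 c) = 0" for c using assms by (simp add: derivation_def)
  show 0: "\<delta> 0 = 0" using const[of 0] by simp
  show minus: "\<delta> (- p) = - \<delta> p" for p
    using add[of p "- p"] 0 by (metis add.right_inverse minus_unique)
  show "\<delta> (p - q) = \<delta> p - \<delta> q" using add[of p "- q"] minus by simp
  show "\<delta> (p\<^sup>2) = 2 * p * \<delta> p" by (simp only: power2_eq_square mult mult_2 distrib_right)
  have "\<delta> 1 = 0" using const[of 1] by simp
  then have "\<delta> (of_nat m) = 0" for m by (induction m) (simp_all add: 0 add)
  from this[of "numeral w"] show "\<delta> (numeral w) = 0" by simp
qed

lemma map_poly_additive:
  assumes "h 0 = 0" "\<And>u v. h (u + v) = h u + h v"
  shows "map_poly h (p + q) = map_poly h p + map_poly h q"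
  by (rule poly_eqI) (simp add: coeff_map_poly assms)

lemma map_poly_multiplicative:
  fixes h :: "'b::comm_ring_1 \<Rightarrow> 'c::comm_ring_1"
  assumes "h 0 = 0" "\<And>u v. h (u + v) = h u + h v" "\<And>u v. h (u * v) = h u * h v"
  shows "map_poly h (p * q) = map_poly h p * map_poly h q"
proof -
  have "h (sum f A) = (\<Sum>i\<in>A. h (f i))" for f :: "nat \<Rightarrow> 'b" and A
    by (induction A rule: infinite_finite_induct) (simp_all add: assms)
  then show ?thesis
    by (intro poly_eqI) (simp add: coeff_map_poly coeff_mult assms)
qed

text \<open>A derivation of the coefficient ring extends to polynomials by killing the new variable.
  Since \<open>dX\<close> and \<open>dY\<close> lift \<open>pderiv\<close> through outer layers in
  this way, the Leibniz rule is inherited layer by layer.\<close>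

lemma map_poly_derivation:
  fixes h :: "'b::comm_ring_1 \<Rightarrow> 'b"
  assumes "h 0 = 0" "\<And>u v. h (u + v) = h u + h v" "\<And>u v. h (u * v) = u * h v + v * h u"
  shows "map_poly h (p * q) = p * map_poly h q + q * map_poly h p"
proof -
  have sum: "h (sum f A) = (\<Sum>i\<in>A. h (f i))" for f :: "nat \<Rightarrow> 'b" and A
    by (induction A rule: infinite_finite_induct) (simp_all add: assms)
  have "map_poly h (p * q) = p * map_poly h q + map_poly h p * q"
    by (intro poly_eqI)
      (simp add: coeff_map_poly coeff_mult assms sum sum.distrib mult.commute[of _ "h _"])
  then show ?thesis by (simp add: mult.commute)
qed

lemma derivation_dX: "derivation dX"
  unfolding derivation_def dX_def const3_def
  by (auto intro!: map_poly_additive map_poly_derivation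
        simp: pderiv_add pderiv_mult map_poly_pCons)

lemma derivation_dY: "derivation dY"
  unfolding derivation_def dY_def const3_def
  by (auto intro!: map_poly_additive map_poly_derivation
        simp: pderiv_add pderiv_mult map_poly_pCons)

lemma partials_X_Y_Z [simp]:
  "dX X = 1" "dX Y = 0" "dX Z = 0"
  "dY X = 0" "dY Y = 1" "dY Z = 0"
  "dZ X = 0" "dZ Y = 0" "dZ Z = 1"
  by (simp_all add: dX_def dY_def dZ_def X_def Y_def Z_def map_poly_pCons pderiv_pCons one_pCons)

lemma derivation_subst1:
  assumes "derivation \<delta>"
  shows "\<delta> (subst1 a p) = subst1 a (pderiv p) * \<delta> a"
  by (induction p) (simp_all add: subst_pCons pderiv_pCons derivation_simps[OF assms] algebra_simps)

lemma derivation_subst2: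
  assumes "derivation \<delta>"
  shows "\<delta> (subst2 a b p) = subst2 a b (map_poly pderiv p) * \<delta> a + subst2 a b (pderiv p) * \<delta> b"
  by (induction p)
    (simp_all add: subst_pCons pderiv_pCons map_poly_pCons derivation_simps[OF assms]
      derivation_subst1[OF assms] algebra_simps)

text \<open>The chain rule, stated for an arbitrary derivation so that one proof covers
  \<open>dX\<close> and \<open>dY\<close>. The induction peels off \<open>z\<close> and leaves the
  coefficients to \<open>derivation_subst2\<close>.\<close>

lemma derivation_subst3:
  assumes "derivation \<delta>"
  shows "\<delta> (subst3 a b c p) =
    subst3 a b c (dX p) * \<delta> a + subst3 a b c (dY p) * \<delta> b + subst3 a b c (dZ p) * \<delta> c"
  unfolding dX_def dY_def dZ_def
  by (induction p)
    (simp_all add: subst_pCons pderiv_pCons map_poly_pCons derivation_simps[OF assms]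
      derivation_subst2[OF assms] algebra_simps)

section \<open>The derivation D and the Jacobian determinant\<close>

definition nagata_deriv :: "'a::idom poly3 \<Rightarrow> 'a poly3" where
  "nagata_deriv p = Z * dY p - 2 * Y * dX p"

lemma derivation_nagata_deriv: "derivation nagata_deriv"
  unfolding derivation_def nagata_deriv_def
  by (auto simp: derivation_simps[OF derivation_dX] derivation_simps[OF derivation_dY] algebra_simps)

lemma partials_nagata:
  "dX (nagata_f \<phi>) = 1 - 2 * (Y + Z * \<phi>) * dX \<phi>"
  "dY (nagata_f \<phi>) = - 2 * \<phi> - 2 * (Y + Z * \<phi>) * dY \<phi>"
  "dX (nagata_g \<phi>) = Z * dX \<phi>"
  "dY (nagata_g \<phi>) = 1 + Z * dY \<phi>"
  unfolding nagata_f_def nagata_g_def mult.assoc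
  by (simp_all only: derivation_simps[OF derivation_dX] derivation_simps[OF derivation_dY]
      partials_X_Y_Z) (simp_all add: algebra_simps power2_eq_square)

lemma det_jacobian_over_Z:
  "det (jacobian a b Z) = dX a * dY b - dY a * dX b"
  by (simp add: jacobian_def det_3 vector_3)

text \<open>With last row (0,0,1) only a 2x2 minor remains. In it the products
  \<open>dX \<phi> * dY \<phi>\<close> cancel, and so do the terms
  \<open>2 * Z * \<phi> * dX \<phi>\<close>.\<close>

lemma det_jacobian_nagata:
  "det (jacobian (nagata_f \<phi>) (nagata_g \<phi>) (nagata_h \<phi>)) = 1 + nagata_deriv \<phi>"
  unfolding nagata_h_def det_jacobian_over_Z partials_nagata nagata_deriv_def
  by (simp add: algebra_simps)

section \<open>Coefficients of elements of the kernel\<close>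

abbreviation mcoeff :: "'a::zero poly3 \<Rightarrow> nat \<Rightarrow> nat \<Rightarrow> nat \<Rightarrow> 'a" where
  "mcoeff p i j k \<equiv> coeff (coeff (coeff p k) j) i"

lemma mcoeff_nagata_deriv:
  fixes p :: "'a::idom poly3"
  shows "mcoeff (nagata_deriv p) i j k =
    (case k of 0 \<Rightarrow> 0 | Suc k' \<Rightarrow> of_nat (Suc j) * mcoeff p i (Suc j) k') -
    (case j of 0 \<Rightarrow> 0 | Suc j' \<Rightarrow> 2 * of_nat (Suc i) * mcoeff p (Suc i) j' k)"
proof -
  have Y: "2 * Y * q = smult [:0, 2:] q" for q :: "'a poly3"
    by (simp add: Y_def numeral_poly algebra_simps)
  have Z: "Z * q = pCons 0 q" for q :: "'a poly3"
    by (simp add: Z_def)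
  show ?thesis
    unfolding nagata_deriv_def Y Z dX_def dY_def
    by (auto simp: coeff_pCons coeff_map_poly coeff_pderiv numeral_poly algebra_simps
        of_nat_poly split: nat.split)
qed

text \<open>Both summands of D carry a factor \<open>Z\<close> or \<open>Y\<close>, so the constant
  term of any value of D vanishes.\<close>

lemma nagata_deriv_const3_imp_0:
  assumes "nagata_deriv p = const3 c"
  shows "c = 0"
  using mcoeff_nagata_deriv[of p 0 0 0] assms by (simp add: const3_def)

context
  fixes p :: "'a::field_char_0 poly3"
  assumes ker: "nagata_deriv p = 0"
begin

text \<open>This is the coefficient of \<open>x^i y^(j+1) z^(k+1)\<close> in
  \<open>nagata_deriv p = 0\<close>. It trades \<open>y^2\<close> for \<open>xz\<close>, and in
  characteristic 0 either side vanishes with the other.\<close>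

lemma mcoeff_step:
  "of_nat (Suc (Suc j)) * mcoeff p i (Suc (Suc j)) k = 2 * of_nat (Suc i) * mcoeff p (Suc i) j (Suc k)"
  using mcoeff_nagata_deriv[of p "Suc k" "Suc j" i] by (simp add: ker)

text \<open>The trade preserves \<open>i - k\<close>, so a coefficient with \<open>k < i\<close> can
  be followed down to \<open>k = 0\<close>; there D has no contribution from \<open>z\<close> and
  forces it to vanish. The exponent \<open>j\<close> grows by 2 at each step, hence is left
  arbitrary.\<close>

lemma mcoeff_eq_0_if_gt:
  "k < i \<Longrightarrow> mcoeff p i j k = 0"
proof (induction k arbitrary: i j)
  case 0
  then obtain i' where "i = Suc i'" by (cases i) auto
  then show ?case
    using mcoeff_nagata_deriv[of p 0 "Suc j" i'] by (simp add: ker del: of_nat_Suc)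
next
  case (Suc k)
  then obtain i' where i: "i = Suc i'" "k < i'" by (cases i) auto
  then show ?case
    using mcoeff_step[of j k i'] Suc.IH[of i' "Suc (Suc j)"] by (simp del: of_nat_Suc)
qed

lemma nagata_deriv_kernel_eq_0:
  assumes "\<And>i k. mcoeff p i 0 k = 0"
  shows "p = 0"
proof -
  have "mcoeff p i j k = 0" for i j k
  proof (induction j arbitrary: i k rule: less_induct)
    case (less j)
    consider "j = 0" | "j = 1" | j' where "j = Suc (Suc j')"
      \<comment> \<open>Each trade lowers \<open>j\<close> by 2, so even exponents end at the
        assumption. Odd ones end at \<open>j = 1\<close>, where the coefficient of
        \<open>y^0\<close> in D sees only the \<open>z\<close> term.\<close>
      by (metis One_nat_def not0_implies_Suc)
    then show ?case
    proof cases
      case 1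
      then show ?thesis by (simp add: assms)
    next
      case 2
      then show ?thesis
        using mcoeff_nagata_deriv[of p "Suc k" 0 i] by (simp add: ker)
    next
      case 3
      then show ?thesis
        using mcoeff_step[of j' k i] less.IH[of j' "Suc k" "Suc i"] by (simp del: of_nat_Suc)
    qed
  qed
  then show ?thesis by (simp add: poly_eq_iff)
qed

end

section \<open>Generators of the kernel\<close>

lemma subst1_monom: "subst1 a (monom c n) = const3 c * a ^ n"
  by (simp add: subst1_def map_poly_monom poly_monom)

lemma subst2_monom: "subst2 a b (monom r n) = subst1 a r * b ^ n"
  by (simp add: subst2_def map_poly_monom poly_monom)

lemma subst2_sum: "subst2 a b (sum f A) = (\<Sum>i\<in>A. subst2 a b (f i))"
  by (induction A rule: infinite_finite_induct) simp_all

lemma nagata_deriv_invariant: "nagata_deriv (subst2 (X * Z + Y\<^sup>2) Z p) = 0"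
proof -
  have "nagata_deriv (X * Z + Y\<^sup>2) = (0::'a poly3)" "nagata_deriv Z = (0::'a poly3)"
    unfolding derivation_simps[OF derivation_nagata_deriv]
    by (simp_all add: nagata_deriv_def algebra_simps)
  then show ?thesis
    by (simp add: derivation_subst2[OF derivation_nagata_deriv])
qed

text \<open>Evaluation at \<open>y = 0\<close>, taken as the constant coefficient in
  \<open>y\<close>; the result lies in \<open>F[x][z]\<close>.\<close>

definition restrict_Y0 :: "'a::comm_ring_1 poly3 \<Rightarrow> 'a poly2" where
  "restrict_Y0 = map_poly (\<lambda>r. coeff r 0)"

lemma restrict_Y0_simps:
  "restrict_Y0 (p + q) = restrict_Y0 p + restrict_Y0 q"
  "restrict_Y0 (p * q) = restrict_Y0 p * restrict_Y0 q"
  "restrict_Y0 0 = 0" "restrict_Y0 1 = 1"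
  by (simp_all add: restrict_Y0_def map_poly_additive map_poly_multiplicative coeff_mult)

lemma restrict_Y0_sum: "restrict_Y0 (sum f A) = (\<Sum>i\<in>A. restrict_Y0 (f i))"
  by (induction A rule: infinite_finite_induct) (simp_all add: restrict_Y0_simps)

lemma restrict_Y0_power: "restrict_Y0 (p ^ n) = restrict_Y0 p ^ n"
  by (induction n) (simp_all add: restrict_Y0_simps)

text \<open>At \<open>y = 0\<close> the generator \<open>xz + y^2\<close> becomes \<open>xz\<close>,
  so \<open>i\<close> of the \<open>k\<close> factors \<open>z\<close> are used up;
  \<open>i \<le> k\<close> makes the subtraction exact.\<close>

lemma restrict_Y0_monomial:
  assumes "i \<le> k"
  shows "restrict_Y0 (const3 c * (X * Z + Y\<^sup>2) ^ i * Z ^ (k - i)) = monom (monom c i) k"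
proof -
  have "restrict_Y0 (const3 c) = [:[:c:]:]"
    by (simp add: restrict_Y0_def const3_def map_poly_pCons)
  moreover have "restrict_Y0 (Z :: 'a poly3) = monom 1 1"
    by (simp add: restrict_Y0_def Z_def map_poly_pCons monom_altdef)
  moreover have "restrict_Y0 (X * Z + Y\<^sup>2 :: 'a poly3) = monom (monom 1 1) 1"
    by (simp add: restrict_Y0_def X_def Y_def Z_def map_poly_pCons monom_altdef power2_eq_square)
  ultimately show ?thesis
    using assms
    by (simp add: restrict_Y0_simps restrict_Y0_power monom_power mult_monom smult_monom)
qed

lemma coeff_restrict_Y0: "coeff (coeff (restrict_Y0 p) k) i = mcoeff p i 0 k"
  by (simp add: restrict_Y0_def coeff_map_poly)

lemma nagata_deriv_kernel:
  fixes \<phi> :: "'a::field_char_0 poly3"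
  assumes "nagata_deriv \<phi> = 0"
  shows "\<exists>p. \<phi> = subst2 (X * Z + Y\<^sup>2) Z p"
proof -
  \<comment> \<open>The exponents are those for which \<open>restrict_Y0_monomial\<close> returns
    the monomial \<open>x^i z^k\<close> of \<phi> at \<open>y = 0\<close>.\<close>
  define p where
    "p = (\<Sum>k\<le>degree \<phi>. \<Sum>i\<le>k. monom (monom (mcoeff \<phi> i 0 k) i) (k - i))"
  define \<psi> where "\<psi> = subst2 (X * Z + Y\<^sup>2) Z p"
  have "restrict_Y0 \<psi> = (\<Sum>k\<le>degree \<phi>. \<Sum>i\<le>k. monom (monom (mcoeff \<phi> i 0 k) i) k)"
    unfolding \<psi>_def p_def
    by (simp add: subst2_sum subst2_monom subst1_monom restrict_Y0_sum restrict_Y0_monomial)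
  moreover have "coeff (coeff (\<Sum>k\<le>degree \<phi>. \<Sum>i\<le>k. monom (monom (mcoeff \<phi> i 0 k) i) k) k) i
      = mcoeff \<phi> i 0 k" for i k
  proof -
    have "coeff (coeff (\<Sum>k\<le>degree \<phi>. \<Sum>i\<le>k. monom (monom (mcoeff \<phi> i 0 k) i) k) k) i
      = (\<Sum>k'\<le>degree \<phi>. \<Sum>i'\<le>k'. if k' = k \<and> i' = i then mcoeff \<phi> i' 0 k' else 0)"
      by (auto simp: coeff_sum intro!: sum.cong)
    also have "\<dots> = (\<Sum>k'\<le>degree \<phi>. if k' = k then \<Sum>i'\<le>k'. if i' = i then mcoeff \<phi> i' 0 k' else 0 else 0)"
      by (intro sum.cong) auto
    also have "\<dots> = (if k \<le> degree \<phi> \<and> i \<le> k then mcoeff \<phi> i 0 k else 0)"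
      by simp
    \<comment> \<open>No monomial is lost: \<open>k > degree \<phi>\<close> is beyond the degree,
      and \<open>i > k\<close> is excluded because \<phi> lies in the kernel.\<close>
    also have "\<dots> = mcoeff \<phi> i 0 k"
      using mcoeff_eq_0_if_gt[OF assms, of k i 0] by (auto simp: coeff_eq_0)
    finally show ?thesis .
  qed
  ultimately have "mcoeff (\<phi> - \<psi>) i 0 k = 0" for i k
    using coeff_restrict_Y0[of \<psi> k i] by simp
  moreover have "nagata_deriv (\<phi> - \<psi>) = 0"
    unfolding derivation_simps(6)[OF derivation_nagata_deriv]
    by (simp add: assms \<psi>_def nagata_deriv_invariant)
  ultimately have "\<phi> - \<psi> = 0"
    by (rule nagata_deriv_kernel_eq_0[rotated])
  then show ?thesis
    unfolding \<psi>_def by auto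
qed

section \<open>The inverse homomorphism\<close>

lemma algebra_hom_nagata: "algebra_hom (nagata \<phi>)"
  unfolding nagata_def by (rule algebra_hom_subst3)

lemma nagata_inverse:
  fixes p :: "'a::comm_ring_1 poly2"
  defines "\<phi> \<equiv> subst2 (X * Z + Y\<^sup>2) Z p"
  defines "\<Psi> \<equiv> subst3 (X + 2 * Y * \<phi> - Z * \<phi>\<^sup>2) (Y - Z * \<phi>) Z"
  shows "nagata \<phi> \<circ> \<Psi> = id" "\<Psi> \<circ> nagata \<phi> = id"
proof -
  note N = algebra_hom_simps[OF algebra_hom_nagata, of \<phi>]
  have hom: "algebra_hom \<Psi>"
    unfolding \<Psi>_def by (rule algebra_hom_subst3)
  note P = algebra_hom_simps[OF hom]
  have NX: "nagata \<phi> X = X - 2 * Y * \<phi> - Z * \<phi>\<^sup>2" "nagata \<phi> Y = Y + Z * \<phi>" "nagata \<phi> Z = Z"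
    by (simp_all add: nagata_def nagata_f_def nagata_g_def nagata_h_def)
  have PX: "\<Psi> X = X + 2 * Y * \<phi> - Z * \<phi>\<^sup>2" "\<Psi> Y = Y - Z * \<phi>" "\<Psi> Z = Z"
    by (simp_all add: \<Psi>_def)
  \<comment> \<open>Both maps fix \<open>xz + y^2\<close> and \<open>z\<close>, hence every
    polynomial in them, in particular \<phi>. In the composites \<phi> then behaves like a
    constant.\<close>
  have "nagata \<phi> (X * Z + Y\<^sup>2) = X * Z + Y\<^sup>2" "\<Psi> (X * Z + Y\<^sup>2) = X * Z + Y\<^sup>2"
    unfolding N P NX PX by (simp_all add: algebra_simps power2_eq_square)
  then have fix_phi: "nagata \<phi> \<phi> = \<phi>" "\<Psi> \<phi> = \<phi>"
    using algebra_hom_subst2[OF algebra_hom_nagata, of \<phi> "X * Z + Y\<^sup>2" Z p]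
      algebra_hom_subst2[OF hom, of "X * Z + Y\<^sup>2" Z p] NX PX
    by (simp_all flip: \<phi>_def)
  have "nagata \<phi> (X + 2 * Y * \<phi> - Z * \<phi>\<^sup>2) = X" "nagata \<phi> (Y - Z * \<phi>) = Y"
    unfolding N NX fix_phi by (simp_all add: algebra_simps power2_eq_square)
  then have "nagata \<phi> (\<Psi> q) = q" for q
    unfolding \<Psi>_def algebra_hom_comp_subst3[OF algebra_hom_nagata]
    by (simp add: NX subst3_X_Y_Z)
  then show "nagata \<phi> \<circ> \<Psi> = id" by auto
  have "\<Psi> (X - 2 * Y * \<phi> - Z * \<phi>\<^sup>2) = X" "\<Psi> (Y + Z * \<phi>) = Y"
    unfolding P PX fix_phi by (simp_all add: algebra_simps power2_eq_square)
  then have "\<Psi> (nagata \<phi> q) = q" for q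
    unfolding nagata_def algebra_hom_comp_subst3[OF hom] nagata_f_def nagata_g_def nagata_h_def
    by (simp add: PX subst3_X_Y_Z)
  then show "\<Psi> \<circ> nagata \<phi> = id" by auto
qed

section \<open>Jacobian determinants of automorphisms\<close>

lemma is_unit_det_jacobian_if_surj:
  fixes a b :: "'a::idom poly3"
  assumes "surj (subst3 a b Z)"
  shows "det (jacobian a b Z) dvd 1"
proof -
  obtain u v where u: "subst3 a b Z u = X" and v: "subst3 a b Z v = Y"
    using assms by (metis surjD)
  define S where "S = subst3 a b Z"
  \<comment> \<open>Differentiating \<open>S u = X\<close> and \<open>S v = Y\<close> in
    \<open>x\<close> and \<open>y\<close> gives a 2x2 inverse of the Jacobian minor; the third chain
    rule term vanishes because \<open>dX Z = dY Z = 0\<close>. Multiplicativity of determinants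
    follows as an explicit identity.\<close>
  have "S (dX u) * dX a + S (dY u) * dX b = 1" "S (dX u) * dY a + S (dY u) * dY b = 0"
    "S (dX v) * dX a + S (dY v) * dX b = 0" "S (dX v) * dY a + S (dY v) * dY b = 1"
    using derivation_subst3[OF derivation_dX, of a b Z u] derivation_subst3[OF derivation_dY, of a b Z u]
      derivation_subst3[OF derivation_dX, of a b Z v] derivation_subst3[OF derivation_dY, of a b Z v]
    by (simp_all add: u v S_def)
  moreover have "(dX a * dY b - dY a * dX b) * (S (dX u) * S (dY v) - S (dY u) * S (dX v)) =
      (S (dX u) * dX a + S (dY u) * dX b) * (S (dX v) * dY a + S (dY v) * dY b) -
      (S (dX u) * dY a + S (dY u) * dY b) * (S (dX v) * dX a + S (dY v) * dX b)"
    by (simp add: algebra_simps)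
  ultimately have "1 = (dX a * dY b - dY a * dX b) * (S (dX u) * S (dY v) - S (dY u) * S (dX v))"
    by simp
  then show ?thesis
    unfolding det_jacobian_over_Z by (rule dvdI)
qed

lemma is_unit_poly3_const:
  fixes p :: "'a::idom poly3"
  assumes "p dvd 1"
  shows "\<exists>c. c \<noteq> 0 \<and> p = const3 c"
  using assms by (auto simp: is_unit_poly_iff const3_def)

theorem corollary3:
  fixes \<phi> :: "'a::field_char_0 poly3"
  shows "((\<exists>c::'a. c \<noteq> 0 \<and>
             det (jacobian (nagata_f \<phi>) (nagata_g \<phi>) (nagata_h \<phi>)) = const3 c)
           \<longleftrightarrow> algebra_automorphism (nagata \<phi>)) \<and>
         (algebra_automorphism (nagata \<phi>) \<longrightarrow>
            (\<exists>p::'a poly2. \<phi> = subst2 (X * Z + Y\<^sup>2) Z p) \<and>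
            nagata \<phi> \<circ> subst3 (X + 2 * Y * \<phi> - Z * \<phi>\<^sup>2) (Y - Z * \<phi>) Z = id \<and>
            subst3 (X + 2 * Y * \<phi> - Z * \<phi>\<^sup>2) (Y - Z * \<phi>) Z \<circ> nagata \<phi> = id)"
    (is "(?J \<longleftrightarrow> ?A) \<and> (?A \<longrightarrow> ?P \<and> ?I1 \<and> ?I2)")
proof -
  \<comment> \<open>The claims are proved around the cycle \<open>?J\<close>, \<open>?P\<close>,
    \<open>?I1 \<and> ?I2\<close>, \<open>?A\<close>, \<open>?J\<close>.\<close>
  have "?P" if ?J
  proof -
    from that obtain c where c: "1 + nagata_deriv \<phi> = const3 c"
      unfolding det_jacobian_nagata by blast
    moreover have "const3 (c - 1) = const3 c - 1"
      by (simp add: const3_def one_pCons)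
    ultimately have "nagata_deriv \<phi> = const3 (c - 1)"
      by (simp add: algebra_simps flip: c)
    then have "nagata_deriv \<phi> = 0"
      using nagata_deriv_const3_imp_0 by fastforce
    then show ?P by (rule nagata_deriv_kernel)
  qed
  moreover have "?I1 \<and> ?I2" if ?P
    using that nagata_inverse by blast
  moreover have ?A if "?I1 \<and> ?I2"
    using that algebra_hom_nagata o_bij unfolding algebra_automorphism_def by blast
  moreover have ?J if ?A
  proof -
    have "surj (subst3 (nagata_f \<phi>) (nagata_g \<phi>) Z)"
      using that by (auto simp: algebra_automorphism_def nagata_def nagata_h_def bij_is_surj)
    then show ?J
      unfolding nagata_h_def using is_unit_det_jacobian_if_surj is_unit_poly3_const by blast
  qed
  ultimately show ?thesis by blast
qed

end
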